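(* For $r\in(0,\frac13]$ let $S_r\subset\mathbb{R}^2$ be the Sierpinski gasket that is the unique nonempty compact set satisfying $S_r=f_1(S_r)\cup f_2(S_r)\cup f_3(S_r)$, where for $\vec{x}\in\mathbb{R}^2$ $$f_1(\vec{x})=r\vec{x},\qquad f_2(\vec{x})=r\vec{x}+(1-r,0),\qquad f_3(\vec{x})=r\vec{x}+(1-r)\left(\tfrac12,\tfrac{\sqrt3}{2}\right),$$ and let $s(r)=\frac{-\log 3}{\log r}$. Then for every $r\in(0,\frac13]$, $$P^{s(r)}(S_r)=\left(2\,\frac{1-r}{r}\right)^{s(r)},$$ where $P^{s}$ denotes the $s$-dimensional packing measure.
   Context: Packing measure: for $A\subset\mathbb{R}^2$, $P^s_\delta(A)=\sup\sum_i|B_i|^s$, the supremum over all countable families of pairwise disjoint closed Euclidean balls $B_i$ centered at points of $A$ with diameters $|B_i|\le\delta$; $P^s_0(A)=\lim_{\delta\to0}P^s_\delta(A)$; and $P^s(A)=\inf\{\sum_{i=1}^\infty P_0^s(U_i): A\subset\bigcup_{i=1}^\infty U_i\}$. *)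

theory Defs
  imports "HOL-Analysis.Analysis"
begin

text \<open>A countable family of pairwise disjoint closed balls is represented as a countable set of
  sets. Nothing is lost, since balls of positive radius are nonempty and hence pairwise disjoint
  members of a family are distinct.\<close>

definition packings :: "real \<Rightarrow> (real^2) set \<Rightarrow> (real^2) set set set" where
  "packings \<delta> A = {\<B>. countable \<B> \<and> disjoint \<B> \<and>
     (\<forall>B\<in>\<B>. (\<exists>x\<in>A. \<exists>\<rho>>0. B = cball x \<rho>) \<and> diameter B \<le> \<delta>)}"

definition packing_delta :: "real \<Rightarrow> real \<Rightarrow> (real^2) set \<Rightarrow> ennreal" where
  "packing_delta s \<delta> A = (SUP \<B>\<in>packings \<delta> A. \<Sum>\<^sub>\<infinity>B\<in>\<B>. ennreal (diameter B powr s))"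

definition packing_premeasure :: "real \<Rightarrow> (real^2) set \<Rightarrow> ennreal" where
  "packing_premeasure s A = Lim (at_right 0) (\<lambda>\<delta>. packing_delta s \<delta> A)"

definition packing_measure :: "real \<Rightarrow> (real^2) set \<Rightarrow> ennreal" where
  "packing_measure s A =
     (INF U\<in>{U :: nat \<Rightarrow> (real^2) set. A \<subseteq> (\<Union>i. U i)}. \<Sum>i. packing_premeasure s (U i))"

lemma packing_delta_mono: "\<delta> \<le> \<epsilon> \<Longrightarrow> packing_delta s \<delta> A \<le> packing_delta s \<epsilon> A"
  unfolding packing_delta_def by (rule SUP_subset_mono) (auto simp: packings_def intro: order_trans)

text \<open>The limit in the definition of the premeasure exists, so \<^const>\<open>Lim\<close> is not underspecified
  there.\<close>

lemma packing_delta_tendsto: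
  "((\<lambda>\<delta>. packing_delta s \<delta> A) \<longlongrightarrow> packing_premeasure s A) (at_right 0)"
proof -
  let ?L = "INF \<delta>\<in>{0<..}. packing_delta s \<delta> A"
  have "((\<lambda>\<delta>. packing_delta s \<delta> A) \<longlongrightarrow> ?L) (at_right 0)"
  proof (rule order_tendstoI)
    fix a assume "a < ?L"
    then have "a < packing_delta s \<delta> A" if "\<delta> > 0" for \<delta>
      using that by (auto intro: less_le_trans INF_lower)
    then show "\<forall>\<^sub>F \<delta> in at_right 0. a < packing_delta s \<delta> A"
      by (auto simp: eventually_at_right_less intro: eventually_mono[OF eventually_at_right_less])
  next
    fix a assume "?L < a"
    then obtain \<epsilon> where "\<epsilon> > 0" "packing_delta s \<epsilon> A < a"
      by (auto simp: INF_less_iff)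
    then have "packing_delta s \<delta> A < a" if "\<delta> < \<epsilon>" for \<delta>
      using that packing_delta_mono[of \<delta> \<epsilon> s A] by (auto intro: le_less_trans)
    then show "\<forall>\<^sub>F \<delta> in at_right 0. packing_delta s \<delta> A < a"
      using \<open>\<epsilon> > 0\<close> by (auto simp: eventually_at_right_field)
  qed
  moreover from this have "packing_premeasure s A = ?L"
    unfolding packing_premeasure_def by (intro tendsto_Lim) auto
  ultimately show ?thesis by simp
qed

definition gasket_f1 :: "real \<Rightarrow> real^2 \<Rightarrow> real^2" where
  "gasket_f1 r x = r *\<^sub>R x"

definition gasket_f2 :: "real \<Rightarrow> real^2 \<Rightarrow> real^2" where
  "gasket_f2 r x = r *\<^sub>R x + vector [1 - r, 0]"

definition gasket_f3 :: "real \<Rightarrow> real^2 \<Rightarrow> real^2" where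
  "gasket_f3 r x = r *\<^sub>R x + (1 - r) *\<^sub>R vector [1/2, sqrt 3 / 2]"

definition sierpinski_gasket :: "real \<Rightarrow> (real^2) set" where
  "sierpinski_gasket r = (THE S. S \<noteq> {} \<and> compact S \<and>
     S = gasket_f1 r ` S \<union> gasket_f2 r ` S \<union> gasket_f3 r ` S)"

definition gasket_dim :: "real \<Rightarrow> real" where
  "gasket_dim r = - ln 3 / ln r"

end

theory Submission
  imports Defs "HOL-Probability.Stream_Space" "HOL-Probability.Probability_Mass_Function"
begin

text \<open>Let \<open>\<mu>\<close> be the self-similar probability measure on the gasket, i.e. the image of the uniform
  measure on sequences of digits, and \<open>C = 3 (2 (1 - r))\<^sup>s\<close>, which equals the claimed value because
  \<open>3 r\<^sup>s = 1\<close>.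

  Upper bound: every ball of diameter \<open>d \<le> 1\<close> centered in the gasket satisfies \<open>d\<^sup>s \<le> C \<mu>(B)\<close>,
  hence so does every packing in total. By scaling it is enough to consider radii in \<open>[r, 1]\<close>.

  Lower bound: the inequality is almost an equality for balls of radius slightly below
  \<open>(1 - r) r\<^sup>n\<close> centered near a vertex of a cell of level \<open>n\<close>. For an arbitrary set \<open>E\<close>, almost every
  point of \<open>E\<close> is arbitrarily close, relative to the size of its cells, to such a vertex, and a greedy
  choice among the resulting balls centered in \<open>E\<close> exhausts almost all of \<open>E\<close>. As no measurability of
  \<open>E\<close> is involved, the bound can be summed over the members of any countable cover.\<close>

subsection \<open>Uniform measure on sequences of digits\<close>

definition digits :: "3 stream measure" where
  "digits = stream_space (measure_pmf (pmf_of_set UNIV))"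

interpretation digits: prob_space digits
  unfolding digits_def by (rule prob_space.prob_space_stream_space) (rule prob_space_measure_pmf)

lemma space_digits [simp]: "space digits = UNIV"
  by (simp add: digits_def space_stream_space)

lemma measurable_Cons_digits [measurable]: "(##) a \<in> measurable digits digits"
  unfolding digits_def by measurable

text \<open>Fubini for the first digit. This recursion and total mass 1 yield every explicit measure
  computed below.\<close>

lemma emeasure_digits:
  assumes "X \<in> sets digits"
  shows "emeasure digits X = (\<Sum>a\<in>UNIV. emeasure digits {\<omega>. a ## \<omega> \<in> X}) / 3"
  using prob_space.emeasure_stream_space[OF prob_space_measure_pmf assms[unfolded digits_def]]
  by (simp add: digits_def space_stream_space nn_integral_pmf_of_set)

lemma measure_digits:
  assumes "X \<in> sets digits"
  shows "measure digits X = (\<Sum>a\<in>UNIV. measure digits {\<omega>. a ## \<omega> \<in> X}) / 3"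
proof -
  have "ennreal (measure digits X) = ennreal ((\<Sum>a\<in>UNIV. measure digits {\<omega>. a ## \<omega> \<in> X}) / 3)"
    using emeasure_digits[OF assms]
    by (simp add: digits.emeasure_eq_measure sum_nonneg divide_ennreal ennreal_divide_numeral)
  then show ?thesis by (simp add: sum_nonneg)
qed

text \<open>Prepending a digit is injective, so the image is an intersection of preimages under the
  measurable maps \<open>shd\<close> and \<open>stl\<close>.\<close>

lemma sets_shift_image [measurable]:
  assumes "D \<in> sets digits"
  shows "shift w ` D \<in> sets digits"
proof (induction w)
  case (Cons a w)
  have [measurable]: "shd \<in> measurable digits (measure_pmf (pmf_of_set (UNIV :: 3 set)))" "stl \<in> measurable digits digits"
    unfolding digits_def by measurable
  have "shift (a # w) ` D = shd -` {a} \<inter> stl -` (shift w ` D)"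
    by (auto simp: image_iff) (metis stream.collapse)
  also have "\<dots> = (shd -` {a} \<inter> space digits) \<inter> (stl -` (shift w ` D) \<inter> space digits)" by simp
  also have "\<dots> \<in> sets digits"
  proof (rule sets.Int)
    show "shd -` {a} \<inter> space digits \<in> sets digits"
      by (rule measurable_sets[where A = "measure_pmf (pmf_of_set (UNIV :: 3 set))"])
        (simp_all add: digits_def del: measurable_pmf_measure2)
    show "stl -` (shift w ` D) \<inter> space digits \<in> sets digits"
      by (rule measurable_sets[OF _ Cons]) auto
  qed
  finally show ?case .
qed (simp add: assms)

lemma measure_shift_image:
  assumes "D \<in> sets digits"
  shows "measure digits (shift w ` D) = measure digits D / 3 ^ length w"
proof (induction w)
  case (Cons a w)
  have "{\<omega>. b ## \<omega> \<in> shift (a # w) ` D} = (if b = a then shift w ` D else {})" for b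
    by auto
  then have "measure digits {\<omega>. b ## \<omega> \<in> shift (a # w) ` D} = (if b = a then measure digits (shift w ` D) else 0)" for b
    by simp
  then show ?case
    using measure_digits[OF sets_shift_image[OF assms, of "a # w"]] Cons by simp
qed simp

definition cell :: "3 list \<Rightarrow> 3 stream set" where "cell w = range (shift w)"

lemma sets_cell [measurable]: "cell w \<in> sets digits"
  unfolding cell_def using sets.top[of digits] by (intro sets_shift_image) auto

lemma measure_cell: "measure digits (cell w) = 1 / 3 ^ length w"
  unfolding cell_def using measure_shift_image[OF sets.top[of digits]] digits.prob_space by simp

section \<open>Shift invariance and runs of a digit\<close>

lemma measurable_sdrop_digits [measurable]: "sdrop n \<in> measurable digits digits"
  unfolding digits_def by measurable

lemma AE_sdrop_digits:
  assumes "AE \<omega> in digits. P \<omega>"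
  shows "AE \<omega> in digits. P (sdrop n \<omega>)"
proof -
  from assms obtain N where N: "N \<in> sets digits" "emeasure digits N = 0" "{\<omega>. \<not> P \<omega>} \<subseteq> N"
    by (auto elim: AE_E)
  have "sdrop n -` N \<in> sets digits" for n
    using measurable_sets[OF measurable_sdrop_digits N(1)] by simp
  moreover have "measure digits (sdrop n -` N) = measure digits N"
  proof (induction n)
    case (Suc n)
    \<comment> \<open>All three sections agree with the preimage one shift earlier, so averaging
      them leaves the measure unchanged.\<close>
    have "{\<omega>. a ## \<omega> \<in> sdrop (Suc n) -` N} = sdrop n -` N" for a by auto
    then show ?case
      using Suc measure_digits[OF \<open>\<And>n. sdrop n -` N \<in> sets digits\<close>, of "Suc n"]
      by (simp del: sdrop.simps)
  qed simp
  ultimately show ?thesis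
    using N by (intro AE_I[of _ _ "sdrop n -` N"]) (auto simp: digits.emeasure_eq_measure)
qed

text \<open>If \<open>Z\<close> is the set of sequences in which \<open>a\<^sup>k\<close> never occurs, then \<open>Z\<close> and its sections above
  runs of the digit \<open>a\<close> all have the same measure, since each of the three sections of \<open>Z\<close> is
  contained in \<open>Z\<close>; but the section above \<open>a\<^sup>k\<close> is empty.\<close>

lemma AE_run_occurs: "AE \<omega> in digits. \<exists>n\<ge>N. sdrop n \<omega> \<in> cell (replicate k (a :: 3))"
proof -
  define Z where "Z = {\<omega>. \<forall>n. sdrop n \<omega> \<notin> cell (replicate k a)}"
  define Zs where "Zs j = {\<omega>. replicate j a @- \<omega> \<in> Z}" for j
  have Z_sets [measurable]: "Z \<in> sets digits"
  proof -
    have "Z = (\<Inter>n. space digits - (sdrop n -` cell (replicate k a) \<inter> space digits))"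
      by (auto simp: Z_def)
    also have "\<dots> \<in> sets digits" by measurable
    finally show ?thesis .
  qed
  have Zs_sets: "Zs j \<in> sets digits" for j
  proof -
    have "shift w \<in> measurable digits digits" for w
      by (induction w) (auto intro: measurable_compose[OF _ measurable_Cons_digits] simp: id_def[symmetric])
    from measurable_sets[OF this Z_sets] show ?thesis by (simp add: Zs_def vimage_def)
  qed
  have tl: "\<omega> \<in> Z" if "w @- \<omega> \<in> Z" for w \<omega>
  proof -
    have "sdrop (length w + n) (w @- \<omega>) = sdrop n \<omega>" for n
      by (simp add: sdrop_shift)
    moreover have "sdrop (length w + n) (w @- \<omega>) \<notin> cell (replicate k a)" for n
      using that unfolding Z_def by blast
    ultimately show ?thesis by (simp add: Z_def)
  qed
  have "measure digits (Zs j) = measure digits Z" for j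
  proof (induction j)
    case 0 then show ?case by (simp add: Zs_def)
  next
    case (Suc j)
    have le: "measure digits {\<omega>. b ## \<omega> \<in> Zs j} \<le> (if b = a then measure digits (Zs (Suc j)) else measure digits Z)" for b
    proof (cases "b = a")
      case True
      have "replicate j a @- a ## \<omega> = replicate (Suc j) a @- \<omega>" for \<omega>
        by (metis replicate_append_same replicate_Suc shift.simps shift_append)
      then show ?thesis using True by (simp add: Zs_def)
    next
      case False
      have "{\<omega>. b ## \<omega> \<in> Zs j} \<subseteq> Z"
        using tl[of "replicate j a @ [b]"] by (auto simp: Zs_def)
      then show ?thesis using False by (auto intro!: digits.finite_measure_mono)
    qed
    have "measure digits Z = (\<Sum>b\<in>UNIV. measure digits {\<omega>. b ## \<omega> \<in> Zs j}) / 3"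
      using Suc measure_digits[OF Zs_sets] by simp
    also have "\<dots> \<le> (\<Sum>b\<in>UNIV. if b = a then measure digits (Zs (Suc j)) else measure digits Z) / 3"
      by (intro divide_right_mono sum_mono le) auto
    also have "\<dots> = (measure digits (Zs (Suc j)) + 2 * measure digits Z) / 3"
      by (subst sum.remove[of _ a]) (auto simp: card_Diff_singleton)
    \<comment> \<open>The three sections average to the measure of \<open>Z\<close> and two of them
      are at most that, so the third is at least that.\<close>
    finally have "measure digits Z \<le> measure digits (Zs (Suc j))" by simp
    moreover have "measure digits (Zs (Suc j)) \<le> measure digits Z"
      using tl by (intro digits.finite_measure_mono) (auto simp: Zs_def simp del: replicate.simps)
    ultimately show ?case by simp
  qed
  moreover have "Zs k = {}"
    by (auto simp: Zs_def Z_def cell_def intro!: exI[of _ 0])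
  ultimately have "measure digits Z = 0" by (metis measure_empty)
  then have "AE \<omega> in digits. \<exists>n. sdrop n \<omega> \<in> cell (replicate k a)"
    using Z_sets by (intro AE_I[of _ _ Z]) (auto simp: Z_def digits.emeasure_eq_measure)
  \<comment> \<open>A run at a position at least \<open>N\<close> is a run in the sequence shifted
    by \<open>N\<close>.\<close>
  then have "AE \<omega> in digits. \<exists>n. sdrop n (sdrop N \<omega>) \<in> cell (replicate k a)"
    by (rule AE_sdrop_digits)
  then show ?thesis by eventually_elim (auto intro: le_add1)
qed

subsection \<open>Packings\<close>

lemma packing_delta_ge:
  assumes "finite \<B>" "\<B> \<in> packings \<delta> A"
  shows "(\<Sum>B\<in>\<B>. ennreal (diameter B powr s)) \<le> packing_delta s \<delta> A"
  unfolding packing_delta_def using assms by (intro SUP_upper2[of \<B>]) auto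

lemma packing_premeasure_le_delta: "0 < \<delta> \<Longrightarrow> packing_premeasure s A \<le> packing_delta s \<delta> A"
  by (rule tendsto_upperbound[OF packing_delta_tendsto])
    (auto simp: eventually_at_right_field intro!: exI[of _ \<delta>] packing_delta_mono)

lemma packing_premeasure_empty: "packing_premeasure s {} = 0"
proof -
  have "\<B> = {}" if "\<B> \<in> packings 1 {}" for \<B> using that by (auto simp: packings_def)
  then have "packing_delta s 1 {} \<le> 0"
    unfolding packing_delta_def by (intro SUP_least) (metis infsum_empty order_refl)
  then show ?thesis using packing_premeasure_le_delta[of 1 s "{}"] by simp
qed

subsection \<open>Coding of the gasket\<close>

text \<open>The fixed points of the three similarities. They form an equilateral triangle of side 1
  whose vertex 1 is the origin.\<close>

definition vert :: "3 \<Rightarrow> real^2" where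
  "vert i = (if i = 1 then 0 else if i = 2 then vector [1, 0] else vector [1/2, sqrt 3 / 2])"

lemma inner_vert: "vert i \<bullet> vert j = (if i = 1 \<or> j = 1 then 0 else if i = j then 1 else 1/2)"
proof -
  have "i = j" if "i \<noteq> 1" "i \<noteq> 2" "j \<noteq> 1" "j \<noteq> 2"
    using exhaust_3[of i] exhaust_3[of j] that by metis
  moreover have "(2::3) \<noteq> 1" by simp
  ultimately show ?thesis
    by (cases "i = 1"; cases "i = 2"; cases "j = 1"; cases "j = 2")
      (simp_all add: vert_def inner_vec_def sum_2)
qed

lemma dist_vert: "dist (vert i) (vert j) = (if i = j then 0 else 1)"
  by (cases "i = 1"; cases "j = 1"; cases "i = j")
    (simp_all add: dist_norm norm_eq_sqrt_inner inner_diff inner_vert)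

text \<open>Seen from one vertex, the other two are unit vectors at an angle of 60 degrees.\<close>

lemma inner_vert_diff: "k \<noteq> i \<Longrightarrow> j \<noteq> i \<Longrightarrow> (vert k - vert i) \<bullet> (vert j - vert i) \<ge> 1/2"
  by (cases "i = 1"; cases "j = 1"; cases "k = 1"; cases "k = j") (simp_all add: inner_diff inner_vert)

locale gasket =
  fixes r :: real
  assumes r_pos: "0 < r" and r_le: "r \<le> 1/3"
begin

definition fmap :: "3 \<Rightarrow> real^2 \<Rightarrow> real^2" where
  "fmap i x = r *\<^sub>R x + (1 - r) *\<^sub>R vert i"

text \<open>The head of the word is the outermost map, so a word names its cell from coarse to fine,
  as the digits of \<open>code\<close> do.\<close>

definition fmaps :: "3 list \<Rightarrow> real^2 \<Rightarrow> real^2" where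
  "fmaps w = foldr fmap w"

lemma fmaps_simps [simp]:
  "fmaps [] x = x" "fmaps (a # w) x = fmap a (fmaps w x)" "fmaps (v @ w) x = fmaps v (fmaps w x)"
  by (simp_all add: fmaps_def)

lemma dist_fmap [simp]: "dist (fmap a x) (fmap a y) = r * dist x y"
  using r_pos by (simp add: fmap_def dist_norm flip: scaleR_diff_right)

lemma dist_fmaps [simp]: "dist (fmaps w x) (fmaps w y) = r ^ length w * dist x y"
  by (induction w) auto

text \<open>The address map of the iterated function system, obtained as a series by unfolding the
  maps forever. The weights sum to 1.\<close>

definition code :: "3 stream \<Rightarrow> real^2" where
  "code \<omega> = (\<Sum>n. ((1 - r) * r ^ n) *\<^sub>R vert (\<omega> !! n))"

lemma norm_vert_le: "norm (vert i) \<le> 1"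
  using dist_vert[of i 1] by (auto simp: vert_def split: if_splits)

lemma norm_code_term: "norm (((1 - r) * r ^ n) *\<^sub>R vert i) \<le> (1 - r) * r ^ n"
  using r_pos r_le norm_vert_le[of i] by (simp add: abs_mult mult_left_le)

lemma geometric_sums: "(\<lambda>n. (1 - r) * r ^ n) sums 1"
  using sums_mult[OF geometric_sums[of r], of "1 - r"] r_pos r_le by simp

lemma summable_code: "summable (\<lambda>n. ((1 - r) * r ^ n) *\<^sub>R vert (\<omega> !! n))"
  using sums_summable[OF geometric_sums] norm_code_term
  by (rule summable_comparison_test'[where N = 0])

lemma norm_code_le: "norm (code \<omega>) \<le> 1"
proof -
  have sm: "summable (\<lambda>n. norm (((1 - r) * r ^ n) *\<^sub>R vert (\<omega> !! n)))"
    by (rule summable_comparison_test'[OF sums_summable[OF geometric_sums], of 0]) (use norm_code_term in auto)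
  have "norm (code \<omega>) \<le> (\<Sum>n. norm (((1 - r) * r ^ n) *\<^sub>R vert (\<omega> !! n)))"
    unfolding code_def by (rule summable_norm[OF sm])
  also have "\<dots> \<le> (\<Sum>n. (1 - r) * r ^ n)"
    by (rule suminf_le[OF norm_code_term sm sums_summable[OF geometric_sums]])
  also have "\<dots> = 1" using sums_unique[OF geometric_sums] by simp
  finally show ?thesis .
qed

lemma code_Cons [simp]: "code (a ## \<omega>) = fmap a (code \<omega>)"
proof -
  have "code (a ## \<omega>) = (1 - r) *\<^sub>R vert a + (\<Sum>n. r *\<^sub>R (((1 - r) * r ^ n) *\<^sub>R vert (\<omega> !! n)))"
    unfolding code_def using suminf_split_head[OF summable_code[of "a ## \<omega>"]]
    by (simp add: algebra_simps)
  also have "\<dots> = fmap a (code \<omega>)"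
    unfolding code_def fmap_def using suminf_scaleR_right[OF summable_code, of r \<omega>]
    by (simp add: add.commute)
  finally show ?thesis .
qed

lemma code_shift [simp]: "code (w @- \<omega>) = fmaps w (code \<omega>)"
  by (induction w) auto

lemma code_unfold: "code \<omega> = fmaps (stake n \<omega>) (code (sdrop n \<omega>))"
  by (metis code_shift stake_sdrop)

section \<open>The gasket as the range of the coding map\<close>

definition triangle :: "(real^2) set" where
  "triangle = convex hull (range vert)"

lemma vert_in_triangle [simp]: "vert i \<in> triangle"
  by (auto simp: triangle_def intro: hull_inc)

lemma triangle_subset:
  assumes "convex K" "\<And>i. vert i \<in> K"
  shows "triangle \<subseteq> K"
  unfolding triangle_def using assms by (intro hull_minimal) auto

lemma closed_triangle: "closed triangle"
  unfolding triangle_def by (intro compact_imp_closed compact_convex_hull finite_imp_compact) simp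

lemma fmap_in_triangle: "x \<in> triangle \<Longrightarrow> fmap a x \<in> triangle"
  using convexD[OF convex_convex_hull, of x "range vert" "vert a" r "1 - r"] r_pos r_le
  by (simp add: fmap_def flip: triangle_def)

lemma fmaps_in_triangle: "x \<in> triangle \<Longrightarrow> fmaps w x \<in> triangle"
  by (induction w) (auto intro: fmap_in_triangle)

text \<open>Composing n maps shrinks distances by \<open>r ^ n\<close>, so the starting points are
  forgotten. They may vary with n, as do the backward orbits in the next inclusion for invariant
  sets.\<close>

lemma fmaps_stake_tendsto:
  assumes "bounded (range x)"
  shows "(\<lambda>n. fmaps (stake n \<omega>) (x n)) \<longlonglongrightarrow> code \<omega>"
proof -
  from assms obtain B where B: "\<And>n. norm (x n) \<le> B" by (auto simp: bounded_iff)
  have "(\<lambda>n. dist (fmaps (stake n \<omega>) (x n)) (code \<omega>)) \<longlonglongrightarrow> 0"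
  proof (rule tendsto_sandwich[where f = "\<lambda>_. 0"])
    have "dist (fmaps (stake n \<omega>) (x n)) (code \<omega>) \<le> r ^ n * (B + 1)" for n
    proof -
      have "dist (x n) (code (sdrop n \<omega>)) \<le> B + 1"
        using B[of n] norm_code_le[of "sdrop n \<omega>"] norm_triangle_ineq4[of "x n" "code (sdrop n \<omega>)"]
        by (simp add: dist_norm)
      then show ?thesis
        using r_pos by (subst code_unfold[of _ n]) (simp add: mult_left_mono)
    qed
    then show "\<forall>\<^sub>F n in sequentially. dist (fmaps (stake n \<omega>) (x n)) (code \<omega>) \<le> r ^ n * (B + 1)" by simp
    show "(\<lambda>n. r ^ n * (B + 1)) \<longlonglongrightarrow> 0"
      using r_pos r_le by (intro tendsto_mult_left_zero LIMSEQ_realpow_zero) auto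
  qed auto
  then show ?thesis by (rule iffD2[OF tendsto_dist_iff])
qed

lemma code_in_triangle: "code \<omega> \<in> triangle"
proof (rule closed_sequentially[OF closed_triangle])
  show "fmaps (stake n \<omega>) (vert 1) \<in> triangle" for n by (intro fmaps_in_triangle) simp
  show "(\<lambda>n. fmaps (stake n \<omega>) (vert 1)) \<longlonglongrightarrow> code \<omega>" by (intro fmaps_stake_tendsto) simp
qed

text \<open>Following a point backwards inside \<open>K\<close> and recording the digits used gives
  an address; the images of the backward orbit are constantly \<open>x\<close> and converge to the
  coded point. Closedness of \<open>K\<close> is not assumed, but the result will be applied to a
  closure.\<close>

lemma invariant_subset_range_code:
  assumes "bounded K" "K \<subseteq> (\<Union>a. fmap a ` K)"
  shows "K \<subseteq> range code"
proof
  fix x assume "x \<in> K"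
  obtain d y where dy: "\<And>x. x \<in> K \<Longrightarrow> y x \<in> K \<and> x = fmap (d x) (y x)"
  proof -
    have "\<forall>x\<in>K. \<exists>p. snd p \<in> K \<and> x = fmap (fst p) (snd p)" using assms(2) by fastforce
    then obtain p where "\<forall>x\<in>K. snd (p x) \<in> K \<and> x = fmap (fst (p x)) (snd (p x))" by metis
    then show ?thesis by (intro that[of "\<lambda>x. snd (p x)" "\<lambda>x. fst (p x)"]) auto
  qed
  define \<omega> where "\<omega> = smap d (siterate y x)"
  have it: "(y ^^ n) x \<in> K \<and> fmaps (stake n \<omega>) ((y ^^ n) x) = x" for n
  proof (induction n)
    case (Suc n)
    have "\<omega> !! n = d ((y ^^ n) x)" by (simp add: \<omega>_def)
    then show ?case using Suc dy[of "(y ^^ n) x"] by (simp add: stake_Suc del: stake.simps)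
  qed (use \<open>x \<in> K\<close> in simp)
  have "bounded (range (\<lambda>n. (y ^^ n) x))"
    using it by (intro bounded_subset[OF assms(1)]) auto
  from fmaps_stake_tendsto[OF this, of \<omega>] it have "code \<omega> = x"
    by (simp add: LIMSEQ_const_iff)
  then show "x \<in> range code" by auto
qed

lemma range_code_subset:
  assumes "closed K" "bounded K" "K \<noteq> {}" "(\<Union>a. fmap a ` K) \<subseteq> K"
  shows "range code \<subseteq> K"
proof safe
  fix \<omega>
  from assms(3) obtain x where x: "x \<in> K" by auto
  have "fmaps w x \<in> K" for w
    using assms(4) x by (induction w) auto
  then show "code \<omega> \<in> K"
    by (intro closed_sequentially[OF assms(1) _ fmaps_stake_tendsto[of "\<lambda>_. x"]]) auto
qed

lemma range_code_invariant: "range code = (\<Union>a. fmap a ` range code)"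
proof -
  have "code \<omega> = fmap (shd \<omega>) (code (stl \<omega>))" for \<omega>
    by (metis code_Cons stream.collapse)
  then have "range code \<subseteq> (\<Union>a. fmap a ` range code)" by blast
  moreover have "fmap a (code \<omega>) \<in> range code" for a \<omega>
    using code_Cons by (metis rangeI)
  ultimately show ?thesis by blast
qed

lemma bounded_range_code: "bounded (range code)"
  using norm_code_le by (auto simp: bounded_iff)

lemma continuous_fmap: "continuous_on A (fmap a)"
  unfolding fmap_def by (intro continuous_intros)

text \<open>The closure of the range lies in the union of its own three images, hence in the range.
  No topology on sequences enters.\<close>

lemma compact_range_code: "compact (range code)"
proof -
  let ?K = "closure (range code)"
  have K: "compact ?K" using bounded_range_code by simp
  have "range code = (\<Union>a. fmap a ` range code)" by (rule range_code_invariant)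
  also have "\<dots> \<subseteq> (\<Union>a. fmap a ` ?K)"
    by (intro UN_mono image_mono closure_subset) auto
  finally have "range code \<subseteq> (\<Union>a. fmap a ` ?K)" .
  moreover have "closed (\<Union>a. fmap a ` ?K)"
    by (intro closed_UN ballI finite compact_imp_closed[OF compact_continuous_image] continuous_fmap K)
  ultimately have "?K \<subseteq> (\<Union>a. fmap a ` ?K)" by (rule closure_minimal)
  then have "?K \<subseteq> range code"
    using K by (intro invariant_subset_range_code compact_imp_bounded)
  then show ?thesis using K closure_subset by (metis subset_antisym)
qed

lemma sierpinski_gasket_eq: "sierpinski_gasket r = range code"
proof -
  have 32: "(3::3) \<noteq> 1" "(3::3) \<noteq> 2" "(2::3) \<noteq> 1" by simp_all
  have f: "gasket_f1 r = fmap 1" "gasket_f2 r = fmap 2" "gasket_f3 r = fmap 3"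
    by (auto simp: fun_eq_iff gasket_f1_def gasket_f2_def gasket_f3_def fmap_def vert_def 32
          vec_eq_iff forall_2 simp del: one_neq_zero)
  have U: "gasket_f1 r ` K \<union> gasket_f2 r ` K \<union> gasket_f3 r ` K = (\<Union>a. fmap a ` K)" for K
    unfolding f UNIV_3 by auto
  show ?thesis
    unfolding sierpinski_gasket_def U
  proof (rule the_equality)
    show "range code \<noteq> {} \<and> compact (range code) \<and> range code = (\<Union>a. fmap a ` range code)"
      by (intro conjI compact_range_code range_code_invariant) blast
    fix K assume K: "K \<noteq> {} \<and> compact K \<and> K = (\<Union>a. fmap a ` K)"
    then have "K \<subseteq> (\<Union>a. fmap a ` K)" "(\<Union>a. fmap a ` K) \<subseteq> K" by simp_all
    with K show "K = range code"
      by (intro subset_antisym invariant_subset_range_code range_code_subset)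
        (auto dest: compact_imp_bounded compact_imp_closed simp only:)
  qed
qed

end

subsection \<open>Upper bound\<close>

text \<open>Dividing by \<open>1 + x\<close> leaves two numbers in [0,1] with sum 1, and each is at
  most its own power with exponent \<open>s <= 1\<close>.\<close>

lemma powr_add_le:
  fixes x s :: real
  assumes "0 \<le> x" "0 \<le> s" "s \<le> 1"
  shows "(1 + x) powr s \<le> 1 + x powr s"
proof (cases "x = 0")
  case False
  have "1 = 1 / (1 + x) + x / (1 + x)" using assms by (simp add: field_simps)
  also have "\<dots> \<le> (1 / (1 + x)) powr s + (x / (1 + x)) powr s"
    using powr_mono'[of s 1 "1 / (1 + x)"] powr_mono'[of s 1 "x / (1 + x)"] assms
    by (intro add_mono) simp_all
  also have "\<dots> = (1 + x powr s) / (1 + x) powr s"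
    using assms by (simp add: powr_divide add_divide_distrib)
  finally show ?thesis using assms False by (simp add: field_simps)
qed simp

context gasket
begin

abbreviation dim :: real where "dim \<equiv> gasket_dim r"

lemma r_powr_dim: "r powr dim = 1/3"
proof -
  have "ln r < 0" using r_pos r_le by simp
  then have "dim * ln r = - ln 3" by (simp add: gasket_dim_def)
  then have "r powr dim = exp (- ln 3)" using r_pos by (simp add: powr_def)
  then show ?thesis by (simp add: exp_minus inverse_eq_divide)
qed

text \<open>The bound \<open>dim <= 1\<close> restates \<open>r <= 1/3\<close>; it makes the power
  function subadditive.\<close>

lemma dim_pos: "0 < dim" and dim_le: "dim \<le> 1"
proof -
  have "ln 3 \<le> ln (1 / r)" using r_pos r_le by (intro ln_mono) (auto simp: field_simps)
  then have "ln r \<le> - ln 3" using r_pos by (simp add: ln_div)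
  moreover have "ln (3::real) > 0" by simp
  ultimately have "ln r < 0" by linarith
  with \<open>ln r \<le> - ln 3\<close> \<open>ln (3::real) > 0\<close> show "0 < dim" "dim \<le> 1"
    by (simp_all add: gasket_dim_def field_simps)
qed

text \<open>Balls are convex, so it suffices to check vertices, first for one point and then for the
  other.\<close>

lemma dist_triangle_le:
  assumes "x \<in> triangle" "y \<in> triangle"
  shows "dist x y \<le> 1"
proof -
  have "triangle \<subseteq> cball (vert i) 1" for i
    by (intro triangle_subset convex_cball) (simp add: dist_vert)
  then have "triangle \<subseteq> cball x 1"
    using assms(1) by (intro triangle_subset convex_cball) (metis mem_cball dist_commute subsetD)
  with assms(2) show ?thesis by auto
qed

text \<open>By convexity only the vertices of cell \<open>i\<close> matter. The corner
  \<open>vert i\<close> attains the bound; for the other two the law of cosines with the 60 degree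
  angle gives a squared distance at most \<open>(1 - r)^2 - r * (1 - 2 * r)\<close>.\<close>

lemma dist_fmap_vert_le:
  assumes "z \<in> triangle" "i \<noteq> j"
  shows "dist (fmap i z) (fmap j (vert i)) \<le> 1 - r"
proof -
  \<comment> \<open>The preimage of \<open>fmap j (vert i)\<close> under \<open>fmap i\<close>; the
    claim becomes containment of the triangle in a ball about it.\<close>
  let ?c = "vert i + ((1 - r) / r) *\<^sub>R (vert j - vert i)"
  have eq: "fmap i z - fmap j (vert i) = r *\<^sub>R (z - ?c)" for z
  proof -
    have "r *\<^sub>R (z - ?c) = r *\<^sub>R z - r *\<^sub>R vert i - (1 - r) *\<^sub>R (vert j - vert i)"
      using r_pos by (simp add: scaleR_diff_right scaleR_add_right)
    then show ?thesis by (simp add: fmap_def algebra_simps)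
  qed
  have le: "norm (fmap i (vert k) - fmap j (vert i)) \<le> 1 - r" for k
  proof (cases "k = i")
    case True
    then have "fmap i (vert k) - fmap j (vert i) = (1 - r) *\<^sub>R (vert i - vert j)"
      by (simp add: fmap_def algebra_simps)
    then show ?thesis using r_le r_pos assms(2) dist_vert[of i j] by (simp add: dist_norm)
  next
    case False
    have "fmap i (vert k) - fmap j (vert i) = r *\<^sub>R (vert k - vert i) - (1 - r) *\<^sub>R (vert j - vert i)"
      by (simp add: fmap_def algebra_simps)
    moreover have "(norm (r *\<^sub>R x - (1 - r) *\<^sub>R y))\<^sup>2
        = r\<^sup>2 * (norm x)\<^sup>2 - 2 * r * (1 - r) * (x \<bullet> y) + (1 - r)\<^sup>2 * (norm y)\<^sup>2" for x y :: "real^2"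
      unfolding power2_norm_eq_inner
      by (simp add: inner_diff inner_commute[of y x]) (simp add: power2_eq_square algebra_simps)
    ultimately have "(norm (fmap i (vert k) - fmap j (vert i)))\<^sup>2
        = r\<^sup>2 * (norm (vert k - vert i))\<^sup>2 - 2 * r * (1 - r) * ((vert k - vert i) \<bullet> (vert j - vert i))
          + (1 - r)\<^sup>2 * (norm (vert j - vert i))\<^sup>2"
      by metis
    also have "\<dots> = r\<^sup>2 - 2 * r * (1 - r) * ((vert k - vert i) \<bullet> (vert j - vert i)) + (1 - r)\<^sup>2"
      using False assms(2) by (simp add: dist_vert flip: dist_norm)
    also have "\<dots> \<le> r\<^sup>2 - 2 * r * (1 - r) * (1/2) + (1 - r)\<^sup>2"
      using inner_vert_diff[OF False, of j] assms(2) r_pos r_le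
      by (intro add_right_mono diff_left_mono mult_left_mono) auto
    also have "\<dots> = (1 - r)\<^sup>2 - r * (1 - 2 * r)" by (simp add: power2_eq_square algebra_simps)
    also have "\<dots> \<le> (1 - r)\<^sup>2" using r_pos r_le by simp
    finally show ?thesis by (rule power2_le_imp_le) (use r_le in simp)
  qed
  have "triangle \<subseteq> cball ?c ((1 - r) / r)"
  proof (intro triangle_subset convex_cball)
    fix k show "vert k \<in> cball ?c ((1 - r) / r)"
      using le[of k] r_pos by (simp only: eq mem_cball dist_norm norm_scaleR norm_minus_commute[of ?c]) (simp add: field_simps)
  qed
  with assms(1) have "norm (z - ?c) \<le> (1 - r) / r"
    by (auto simp: dist_norm norm_minus_commute)
  then show ?thesis using r_pos by (simp only: dist_norm eq norm_scaleR) (simp add: field_simps)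
qed

section \<open>Measure captured by balls centered in the gasket\<close>

lemma vert_in_range_code: "vert i \<in> range code"
proof -
  have "code (sconst i) = fmap i (code (sconst i))"
    by (metis code_Cons siterate.code id_apply)
  then have "(1 - r) *\<^sub>R (code (sconst i) - vert i) = 0"
    by (simp add: fmap_def algebra_simps)
  then have "vert i = code (sconst i)" using r_le by simp
  then show ?thesis by (rule range_eqI)
qed

text \<open>A lower bound for the measure of a ball through a measurable witness set of sequences,
  so that measurability of \<open>code\<close> is never at issue.\<close>

definition captures :: "real^2 \<Rightarrow> real \<Rightarrow> real \<Rightarrow> bool" where
  "captures x u m \<longleftrightarrow> (\<exists>D\<in>sets digits. code ` D \<subseteq> cball x u \<and> m \<le> measure digits D)"

lemma captures_fmap:
  assumes "captures x u m"
  shows "captures (fmap a x) (r * u) (m / 3)"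
proof -
  from assms obtain D where D: "D \<in> sets digits" "code ` D \<subseteq> cball x u" "m \<le> measure digits D"
    by (auto simp: captures_def)
  have "code ` shift [a] ` D \<subseteq> cball (fmap a x) (r * u)"
    using D(2) r_pos by auto
  then show ?thesis
    unfolding captures_def using D measure_shift_image[OF D(1), of "[a]"] sets_shift_image[OF D(1), of "[a]"]
    by (intro bexI[of _ "shift [a] ` D"]) auto
qed

text \<open>Since \<open>r powr dim = 1/3\<close>, the bound scales exactly as in
  \<open>captures_fmap\<close>. Passing to the cell of the center enlarges small radii by
  \<open>1 / r\<close> until they lie in [r, 1].\<close>

lemma captures_powr:
  assumes coarse: "\<And>x u. x \<in> range code \<Longrightarrow> r \<le> u \<Longrightarrow> u \<le> 1 \<Longrightarrow> captures x u (c * u powr dim)"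
  assumes "x \<in> range code" "0 < u" "u \<le> 1"
  shows "captures x u (c * u powr dim)"
proof -
  obtain n where "r ^ n < u" using real_arch_pow_inv[of u r] assms r_le by auto
  then show ?thesis using assms(2-)
  proof (induction n arbitrary: x u)
    case (Suc n)
    show ?case
    proof (cases "r \<le> u")
      case False
      from Suc.prems(2) range_code_invariant obtain a y where y: "y \<in> range code" "x = fmap a y"
        by blast
      have "captures y (u / r) (c * (u / r) powr dim)"
        using Suc.prems False r_pos y by (intro Suc.IH) (auto simp: field_simps)
      from captures_fmap[OF this, of a] show ?thesis
        using r_pos Suc.prems by (simp add: y powr_divide r_powr_dim)
    qed (use coarse Suc.prems in blast)
  qed simp
qed

lemma code_cell_subset: "code ` cell [a] \<subseteq> cball (fmap a (code \<omega>)) r"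
  using r_pos dist_triangle_le[OF code_in_triangle code_in_triangle]
  by (auto simp: cell_def mult_left_le)

lemma captures_coarse:
  assumes "x \<in> range code" "r \<le> u" "m \<le> 1/3"
  shows "captures x u m"
proof -
  from assms(1) range_code_invariant obtain a \<omega> where "x = fmap a (code \<omega>)" by blast
  then have "code ` cell [a] \<subseteq> cball x u"
    using code_cell_subset[of a \<omega>] subset_cball[OF assms(2)] by blast
  then show ?thesis
    unfolding captures_def using assms(3) by (intro bexI[of _ "cell [a]"]) (auto simp: measure_cell)
qed

text \<open>Not sharp, but sufficient for the small pieces near vertices in the sharp
  estimate.\<close>

lemma captures_crude:
  assumes "x \<in> range code" "0 < u" "u \<le> 1"
  shows "captures x u (1/3 * u powr dim)"
  using _ assms
proof (rule captures_powr)
  fix x u assume *: "x \<in> range code" "r \<le> u" "u \<le> 1"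
  have "u powr dim \<le> 1" using * r_pos dim_pos by (intro powr_le1) auto
  then show "captures x u (1/3 * u powr dim)" using * by (intro captures_coarse) auto
qed

text \<open>A ball of radius \<open>1 - r + t\<close> about a point of the cell \<open>a\<close> contains this cell and, in each
  of the other two cells, the part within distance \<open>t\<close> of the vertex closest to the cell \<open>a\<close>.\<close>

lemma captures_sharp:
  assumes "x \<in> range code" "0 < u" "u \<le> 1"
  shows "captures x u (1 / (3 * (1 - r) powr dim) * u powr dim)"
  using _ assms
proof (rule captures_powr)
  fix x u assume *: "x \<in> range code" "r \<le> u" "u \<le> 1"
  have eq: "1 / (3 * (1 - r) powr dim) * u powr dim = (u / (1 - r)) powr dim / 3"
    using * r_pos r_le by (simp add: powr_divide)
  have "captures x u ((u / (1 - r)) powr dim / 3)"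
  proof (cases "u \<le> 1 - r")
    case True
    then have "(u / (1 - r)) powr dim \<le> 1" using * r_pos r_le dim_pos by (intro powr_le1) auto
    then show ?thesis using * by (intro captures_coarse) auto
  next
    case False
    define t where "t = u - (1 - r)"
    have t: "0 < t" "t \<le> r" using False * by (auto simp: t_def)
    from *(1) range_code_invariant obtain a \<omega> where x: "x = fmap a (code \<omega>)" by blast
    \<comment> \<open>Scaled by \<open>r\<close> into another cell, radius \<open>t / r\<close>
      becomes \<open>t\<close>; the factor 1/3 cancels against \<open>r powr dim\<close>.\<close>
    have "captures (vert a) (t / r) (1/3 * (t / r) powr dim)"
      using t r_pos by (intro captures_crude vert_in_range_code) auto
    then obtain D where D: "D \<in> sets digits" "code ` D \<subseteq> cball (vert a) (t / r)" "t powr dim \<le> measure digits D"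
      using t r_pos by (auto simp: captures_def powr_divide r_powr_dim)
    define E where "E = (\<Union>b. shift [b] ` (if b = a then UNIV else D))"
    have E_sets: "E \<in> sets digits"
      unfolding E_def using D(1) sets.top[of digits] by (intro sets.finite_UN sets_shift_image) auto
    have "{\<omega>. b ## \<omega> \<in> E} = (if b = a then UNIV else D)" for b
      by (auto simp: E_def split: if_splits)
    then have "measure digits {\<omega>. b ## \<omega> \<in> E} = (if b = a then 1 else measure digits D)" for b
      using digits.prob_space by simp
    then have "measure digits E = (\<Sum>b\<in>UNIV. if b = a then 1 else measure digits D) / 3"
      using measure_digits[OF E_sets] by simp
    also have "\<dots> = (1 + 2 * measure digits D) / 3"
      by (subst sum.remove[of _ a]) (auto simp: card_Diff_singleton)
    finally have mE: "measure digits E = (1 + 2 * measure digits D) / 3" .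
    have sub: "dist x (code \<xi>) \<le> u" if "\<xi> \<in> E" for \<xi>
    proof -
      from that obtain b \<zeta> where b: "\<xi> = b ## \<zeta>" "b \<noteq> a \<Longrightarrow> \<zeta> \<in> D"
        by (auto simp: E_def split: if_splits)
      show ?thesis
      proof (cases "b = a")
        case True
        then show ?thesis
          using b dist_triangle_le[OF code_in_triangle code_in_triangle, of \<omega> \<zeta>] r_pos *(2)
          by (simp add: x) (meson mult_left_le order.trans less_imp_le)
      next
        case False
        have "dist x (code \<xi>) \<le> dist x (fmap b (vert a)) + dist (fmap b (vert a)) (fmap b (code \<zeta>))"
          unfolding b code_Cons by (rule dist_triangle)
        also have "\<dots> \<le> (1 - r) + r * (t / r)"
          unfolding dist_fmap using b(2)[OF False] D(2) r_pos False
          by (intro add_mono mult_left_mono) (auto simp: x intro!: dist_fmap_vert_le code_in_triangle)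
        also have "\<dots> = u" using r_pos by (simp add: t_def)
        finally show ?thesis .
      qed
    qed
    have "(u / (1 - r)) powr dim = (1 + t / (1 - r)) powr dim"
      using r_le by (simp add: t_def add_divide_distrib[symmetric] field_simps)
    also have "\<dots> \<le> 1 + (t / (1 - r)) powr dim"
      using t r_le dim_pos dim_le by (intro powr_add_le) auto
    also have "(t / (1 - r)) powr dim = t powr dim / (1 - r) powr dim"
      using t r_le by (simp add: powr_divide)
    \<comment> \<open>The two other cells together supply \<open>2 * t powr dim\<close>, which
      suffices as \<open>(1 - r) powr dim >= 1 - r >= 1/2\<close>.\<close>
    also have "\<dots> \<le> t powr dim / (1/2)"
    proof (rule divide_left_mono)
      have "1 - r \<le> (1 - r) powr dim" using powr_mono'[of dim 1 "1 - r"] dim_le r_pos r_le by simp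
      then show "1/2 \<le> (1 - r) powr dim" using r_le by simp
    qed (use r_le in auto)
    also have "1 + \<dots> \<le> 1 + 2 * measure digits D" using D(3) by simp
    finally have "(u / (1 - r)) powr dim / 3 \<le> measure digits E" by (simp add: mE)
    then show ?thesis unfolding captures_def using E_sets sub by (intro bexI[of _ E]) auto
  qed
  then show "captures x u (1 / (3 * (1 - r) powr dim) * u powr dim)" unfolding eq .
qed

text \<open>Disjoint balls capture disjoint sets of sequences, of total measure at most 1. The
  factor 2 converts radii to diameters.\<close>

lemma packing_delta_le: "packing_delta dim 1 (range code) \<le> ennreal (3 * (2 * (1 - r)) powr dim)"
  unfolding packing_delta_def
proof (rule SUP_least)
  let ?C = "3 * (2 * (1 - r)) powr dim"
  fix \<B> assume \<B>: "\<B> \<in> packings 1 (range code)"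
  then have disj: "disjoint \<B>" by (simp add: packings_def)
  have ball: "\<exists>x\<in>range code. \<exists>\<rho>>0. B = cball x \<rho> \<and> \<rho> \<le> 1/2" if "B \<in> \<B>" for B
  proof -
    from \<B> that obtain x \<rho> where x: "x \<in> range code" "\<rho> > 0" "B = cball x \<rho>" "diameter B \<le> 1"
      unfolding packings_def by blast
    then have "\<rho> \<le> 1/2" by simp
    with x show ?thesis by blast
  qed
  have "\<exists>D\<in>sets digits. code ` D \<subseteq> B \<and> diameter B powr dim \<le> ?C * measure digits D" if B: "B \<in> \<B>" for B
  proof -
    from ball[OF B] obtain x \<rho> where x: "x \<in> range code" "0 < \<rho>" "\<rho> \<le> 1/2" "B = cball x \<rho>" by blast
    from captures_sharp[of x \<rho>] x obtain D where D: "D \<in> sets digits" "code ` D \<subseteq> cball x \<rho>"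
      "1 / (3 * (1 - r) powr dim) * \<rho> powr dim \<le> measure digits D"
      by (auto simp: captures_def)
    have "diameter B powr dim = ?C * (1 / (3 * (1 - r) powr dim) * \<rho> powr dim)"
      using x r_le powr_mult[of 2 "1 - r" dim] powr_mult[of 2 \<rho> dim]
      by (simp add: powr_mult del: mult_minus_right right_diff_distrib_numeral)
    also have "\<dots> \<le> ?C * measure digits D" using D(3) by (intro mult_left_mono) auto
    finally show ?thesis using D x by blast
  qed
  then obtain D where D: "\<And>B. B \<in> \<B> \<Longrightarrow> D B \<in> sets digits" "\<And>B. B \<in> \<B> \<Longrightarrow> code ` D B \<subseteq> B"
    "\<And>B. B \<in> \<B> \<Longrightarrow> diameter B powr dim \<le> ?C * measure digits (D B)"
    by metis
  have "(\<Sum>B\<in>\<F>. ennreal (diameter B powr dim)) \<le> ennreal ?C" if F: "finite \<F>" "\<F> \<subseteq> \<B>" for \<F>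
  proof -
    have "disjoint_family_on D \<F>"
      unfolding disjoint_family_on_def
    proof (intro ballI impI equals0I)
      fix A B \<omega> assume AB: "A \<in> \<F>" "B \<in> \<F>" "A \<noteq> B" "\<omega> \<in> D A \<inter> D B"
      then have "code \<omega> \<in> A" "code \<omega> \<in> B" using D(2) F by blast+
      moreover have "disjnt A B" using disj AB F by (auto simp: pairwise_def)
      ultimately show False by (auto simp: disjnt_def)
    qed
    then have "(\<Sum>B\<in>\<F>. measure digits (D B)) = measure digits (\<Union>B\<in>\<F>. D B)"
      using D(1) F by (intro digits.finite_measure_finite_Union[symmetric]) auto
    also have "\<dots> \<le> 1" by (rule digits.prob_le_1)
    finally have le1: "(\<Sum>B\<in>\<F>. measure digits (D B)) \<le> 1" .
    have "(\<Sum>B\<in>\<F>. diameter B powr dim) \<le> (\<Sum>B\<in>\<F>. ?C * measure digits (D B))"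
      using D(3) F by (intro sum_mono) auto
    also have "\<dots> = ?C * (\<Sum>B\<in>\<F>. measure digits (D B))" by (simp add: sum_distrib_left)
    also have "\<dots> \<le> ?C" using le1 by (intro mult_left_le) auto
    finally show ?thesis by simp
  qed
  then show "(\<Sum>\<^sub>\<infinity>B\<in>\<B>. ennreal (diameter B powr dim)) \<le> ennreal ?C"
    by (subst nonneg_infsum_complete) (auto intro!: SUP_least)
qed

lemma packing_measure_le: "packing_measure dim (range code) \<le> ennreal (3 * (2 * (1 - r)) powr dim)"
proof -
  define U where "U i = (if i = 0 then range code else {})" for i :: nat
  have "packing_measure dim (range code) \<le> (\<Sum>i. packing_premeasure dim (U i))"
    unfolding packing_measure_def by (rule INF_lower) (auto simp: U_def split: if_splits)
  also have "\<dots> = (\<Sum>i\<in>{0}. packing_premeasure dim (U i))"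
    by (intro suminf_finite) (auto simp: U_def packing_premeasure_empty)
  also have "\<dots> \<le> packing_delta dim 1 (range code)"
    using packing_premeasure_le_delta[of 1 dim "range code"] by (simp add: U_def)
  also note packing_delta_le
  finally show ?thesis .
qed

end

subsection \<open>Lower bound\<close>

lemma list_compare:
  "w = w' \<or> (\<exists>a u. w = w' @ a # u) \<or> (\<exists>a u. w' = w @ a # u) \<or>
    (\<exists>v a u b u'. a \<noteq> b \<and> w = v @ a # u \<and> w' = v @ b # u')"
proof (induction w arbitrary: w')
  case Nil
  then show ?case by (cases w') auto
next
  case (Cons x w)
  show ?case
  proof (cases w')
    case (Cons y z)
    show ?thesis
    proof (cases "x = y")
      case True
      from Cons.IH[of z] show ?thesis unfolding Cons True by (metis append_Cons)
    next
      case False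
      then show ?thesis unfolding Cons by (metis append_Nil)
    qed
  qed simp
qed

lemma not_replicate_split:
  assumes "\<And>l. u \<noteq> replicate l a"
  obtains j b z where "b \<noteq> a" "u = replicate j a @ b # z"
proof -
  have "\<exists>x\<in>set u. x \<noteq> a" using replicate_length_same[of u a] assms by metis
  then obtain ys x zs where "u = ys @ x # zs" "x \<noteq> a" "\<forall>y\<in>set ys. y = a"
    using split_list_first_prop[of u "\<lambda>x. x \<noteq> a"] by blast
  then show ?thesis using that[of x "length ys" zs] replicate_length_same[of ys a] by simp
qed

text \<open>A word \<open>w\<close> stands for a ball of radius slightly below \<open>(1 - r) r\<^sup>n\<close>, \<open>n = |w|\<close>, around the
  vertex \<open>1\<close> of the cell \<open>w\<close>; it meets the gasket in the subcell \<open>w1\<close> only. A longer word is shadowed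
  by \<open>w\<close> if it lies in this subcell, or if its ball may meet the one of \<open>w\<close>.\<close>

definition shadows :: "3 list \<Rightarrow> 3 list \<Rightarrow> bool" where
  "shadows w' w \<longleftrightarrow> (\<exists>u. w = w' @ 1 # u) \<or> (\<exists>a l. w = w' @ a # replicate l 1)"

text \<open>Words are selected in order of length. The length guard makes the recursion well
  founded, and every shadowing word satisfies it by \<open>shadows_length\<close>.\<close>

function greedy :: "(3 list \<Rightarrow> bool) \<Rightarrow> 3 list \<Rightarrow> bool" where
  "greedy P w \<longleftrightarrow> P w \<and> (\<forall>w'. length w' < length w \<longrightarrow> shadows w' w \<longrightarrow> \<not> greedy P w')"
  by auto
termination by (relation "Wellfounded.measure (\<lambda>(P, w). length w)") auto

declare greedy.simps [simp del]

lemma shadows_length: "shadows w' w \<Longrightarrow> length w' < length w"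
  by (auto simp: shadows_def)

lemma greedy_not_shadows: "greedy P w \<Longrightarrow> greedy P w' \<Longrightarrow> \<not> shadows w' w"
  using greedy.simps[of P w] shadows_length by blast

context gasket
begin

section \<open>Separation of the balls attached to words\<close>

lemma inner_triangle_nonneg: "y \<in> triangle \<Longrightarrow> 0 \<le> vert a \<bullet> y"
proof -
  have "triangle \<subseteq> {x. vert a \<bullet> x \<ge> 0}"
    by (intro triangle_subset convex_halfspace_ge) (simp add: inner_vert)
  then show "y \<in> triangle \<Longrightarrow> 0 \<le> vert a \<bullet> y" by blast
qed

lemma zero_in_triangle: "0 \<in> triangle"
  using vert_in_triangle[of 1] by (simp add: vert_def)

lemma fmaps_append_replicate_1: "fmaps (replicate j 1) x = r ^ j *\<^sub>R x"
  by (induction j) (auto simp: fmap_def vert_def)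

text \<open>After removing the common prefix, distinct cells are at least \<open>1 - 2 * r\<close>
  apart, which exceeds the sum of the radii unless both remaining words are single letters. In that
  case the gap can be too small, but the center distance is exactly \<open>1 - r\<close>.\<close>

lemma centres_apart_branching:
  assumes "a \<noteq> b" "w = v @ a # u" "w' = v @ b # u'"
  shows "(1 - r) * (r ^ length w + r ^ length w') < dist (fmaps w 0) (fmaps w' 0)"
proof -
  have "(1 - r) * (r ^ Suc (length u) + r ^ Suc (length u')) < dist (fmap a (fmaps u 0)) (fmap b (fmaps u' 0))"
  proof (cases "u = [] \<and> u' = []")
    case True
    have "fmap a 0 - fmap b 0 = (1 - r) *\<^sub>R (vert a - vert b)"
      by (simp add: fmap_def algebra_simps)
    then have "dist (fmap a 0) (fmap b 0) = 1 - r"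
      using dist_vert[of a b] assms(1) r_le by (simp add: dist_norm)
    moreover have "(1 - r) * (r + r) < (1 - r) * 1" using r_pos r_le by (intro mult_strict_left_mono) auto
    ultimately show ?thesis using True by simp
  next
    case False
    have pow: "r ^ m \<le> 1" for m using r_pos r_le by (intro power_le_one) auto
    from False have "1 \<le> length u + length u'" by (cases u; cases u') auto
    then consider "1 \<le> length u" | "1 \<le> length u'" by linarith
    then have "r ^ length u + r ^ length u' \<le> 1 + r"
    proof cases
      case 1
      then have "r ^ length u \<le> r ^ 1" using r_pos r_le by (intro power_decreasing) auto
      then show ?thesis using pow[of "length u'"] by simp
    next
      case 2
      then have "r ^ length u' \<le> r ^ 1" using r_pos r_le by (intro power_decreasing) auto
      then show ?thesis using pow[of "length u"] by simp
    qed
    then have "(1 - r) * r * (r ^ length u + r ^ length u') \<le> (1 - r) * r * (1 + r)"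
      using r_pos r_le by (intro mult_left_mono) auto
    also have "\<dots> = r - r ^ 3" by (simp add: power3_eq_cube algebra_simps)
    also have "\<dots> < 1 - 2 * r" using r_pos r_le zero_less_power[of r 3] by linarith
    also have "\<dots> \<le> (1 - r) - r * dist (fmaps u 0) (fmaps u' 0)"
      using r_pos dist_triangle_le[OF fmaps_in_triangle fmaps_in_triangle, OF zero_in_triangle zero_in_triangle, of u u']
      by (simp add: mult_left_le)
    also have "\<dots> = norm ((1 - r) *\<^sub>R (vert a - vert b)) - norm (r *\<^sub>R (fmaps u' 0 - fmaps u 0))"
      using dist_vert[of a b] assms(1) r_pos r_le by (simp add: dist_norm norm_minus_commute)
    also have "\<dots> \<le> norm ((1 - r) *\<^sub>R (vert a - vert b) - r *\<^sub>R (fmaps u' 0 - fmaps u 0))"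
      by (rule norm_triangle_ineq2)
    also have "(1 - r) *\<^sub>R (vert a - vert b) - r *\<^sub>R (fmaps u' 0 - fmaps u 0)
        = fmap a (fmaps u 0) - fmap b (fmaps u' 0)"
      by (simp add: fmap_def algebra_simps)
    finally show ?thesis by (simp add: dist_norm algebra_simps)
  qed
  from mult_strict_left_mono[OF this, of "r ^ length v"] show ?thesis
    using r_pos assms(2,3) by (simp add: power_add algebra_simps)
qed

text \<open>Scale the shorter word away, so that its center is the origin, and project onto
  \<open>vert a\<close>. The first digit gives \<open>1 - r\<close>; the first later digit
  \<open>b\<close> other than 1 adds at least \<open>r ^ (j + 1) * (1 - r) / 2\<close>, more than
  the radius of the longer word.\<close>

lemma centres_apart_nested:
  assumes "w = w' @ a # u" "\<not> shadows w' w"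
  shows "(1 - r) * (r ^ length w + r ^ length w') < dist (fmaps w 0) (fmaps w' 0)"
proof -
  have "a \<noteq> 1" "\<And>l. u \<noteq> replicate l 1" using assms by (auto simp: shadows_def)
  from not_replicate_split[OF this(2)] obtain j b z where u: "b \<noteq> 1" "u = replicate j 1 @ b # z" by blast
  let ?y = "fmaps z 0"
  have "r ^ (length z + 1) \<le> r ^ 1" using r_pos r_le by (intro power_decreasing) auto
  then have "r ^ (length z + 1) < 1/2" using r_le unfolding power_one_right by linarith
  then have "r ^ (j + 1) * r ^ (length z + 1) < r ^ (j + 1) * (1/2)"
    by (rule mult_strict_left_mono) (use r_pos in simp)
  then have "(1 - r) * (r ^ Suc (length u) + 1) < (1 - r) * (1 + r ^ (j + 1) * (1/2))"
    using r_pos r_le u by (intro mult_strict_left_mono) (auto simp: power_add algebra_simps)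
  also have "\<dots> = (1 - r) + r ^ (j + 1) * ((1 - r) * (1/2))" by (simp add: algebra_simps)
  also have "\<dots> \<le> (1 - r) + r ^ (j + 1) * (r * (vert a \<bullet> ?y) + (1 - r) * (vert a \<bullet> vert b))"
  proof (intro add_left_mono mult_left_mono)
    have "0 \<le> vert a \<bullet> ?y" by (intro inner_triangle_nonneg fmaps_in_triangle zero_in_triangle)
    moreover have "1/2 \<le> vert a \<bullet> vert b" using \<open>a \<noteq> 1\<close> u(1) by (simp add: inner_vert)
    ultimately have "0 \<le> r * (vert a \<bullet> ?y)" "(1 - r) * (1/2) \<le> (1 - r) * (vert a \<bullet> vert b)"
      using r_pos r_le by (auto intro!: mult_left_mono)
    then show "(1 - r) * (1/2) \<le> r * (vert a \<bullet> ?y) + (1 - r) * (vert a \<bullet> vert b)" by linarith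
  qed (use r_pos in auto)
  also have "\<dots> = vert a \<bullet> fmap a (fmaps u 0)"
    using \<open>a \<noteq> 1\<close> by (simp add: u fmaps_append_replicate_1 fmap_def inner_vert algebra_simps)
  also have "\<dots> \<le> norm (vert a) * norm (fmap a (fmaps u 0))" by (rule norm_cauchy_schwarz)
  also have "\<dots> \<le> dist (fmap a (fmaps u 0)) 0"
    using mult_right_mono[OF norm_vert_le] by simp
  finally have "(1 - r) * (r ^ Suc (length u) + 1) < dist (fmap a (fmaps u 0)) 0" .
  from mult_strict_left_mono[OF this, of "r ^ length w'"] show ?thesis
    using r_pos dist_fmaps[of w' "fmap a (fmaps u 0)" 0] by (simp add: assms(1) power_add algebra_simps)
qed

lemma centres_apart:
  assumes "w \<noteq> w'" "\<not> shadows w w'" "\<not> shadows w' w"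
  shows "(1 - r) * (r ^ length w + r ^ length w') < dist (fmaps w 0) (fmaps w' 0)"
  using list_compare[of w w']
proof (elim disjE exE conjE)
  fix a u assume "w' = w @ a # u"
  from centres_apart_nested[OF this assms(2)] show ?thesis by (simp add: add.commute dist_commute)
qed (use assms centres_apart_nested centres_apart_branching in blast)+

text \<open>The part of the set missed by the subcells of the greedily chosen words lies, up to a null set,
  in cells \<open>wa1\<^sup>k\<close> with \<open>w\<close> chosen, so that it has small measure.\<close>

lemma packing_delta_lower:
  assumes k: "1 \<le> k" and "0 < \<delta>"
  shows "\<exists>D\<in>sets digits. code -` E \<subseteq> D \<and>
    ennreal (3 * (2 * (1 - r - r ^ k)) powr dim / (1 + 3 / 3 ^ k)) * emeasure digits D \<le> packing_delta dim \<delta> E"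
proof -
  obtain N where N: "r ^ N < \<delta> / 2" using real_arch_pow_inv[of "\<delta>/2" r] assms r_le by auto
  \<comment> \<open>A run of \<open>k\<close> ones puts a point of \<open>E\<close> within relative
    distance \<open>r ^ k\<close> of vertex 1 of the cell.\<close>
  define P where "P w \<longleftrightarrow> N \<le> length w \<and> (\<exists>\<omega>. code \<omega> \<in> E \<and> \<omega> \<in> cell (w @ replicate k 1))" for w
  define W where "W n = {w. greedy P w \<and> length w \<le> n}" for n
  define X where "X w = cell (w @ [1]) \<union> (\<Union>a. cell (w @ a # replicate k 1))" for w
  \<comment> \<open>A chosen word contributes \<open>?c / 3 ^ length w\<close> to the packing and
    uses up measure at most \<open>?q / 3 ^ length w\<close>: a third for the subcell
    \<open>w1\<close>, and three cells that are smaller by \<open>3 ^ (k + 1)\<close>.\<close>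
  let ?c = "(2 * (1 - r - r ^ k)) powr dim" and ?q = "(1 + 3 / 3 ^ k) / (3::real)"
  have W_fin: "finite (W n)" for n
    using finite_lists_length_le[of "UNIV :: 3 set" n] by (rule finite_subset[rotated]) (auto simp: W_def)
  have "r ^ k \<le> r ^ 1" using k r_pos r_le by (intro power_decreasing) auto
  then have rk: "0 < 1 - r - r ^ k" using r_le by simp
  have P: "P w" if "greedy P w" for w using that greedy.simps[of P w] by blast
  obtain x where x: "\<And>w. greedy P w \<Longrightarrow> x w \<in> E" "\<And>w. greedy P w \<Longrightarrow> dist (x w) (fmaps w 0) \<le> r ^ length w * r ^ k"
  proof -
    have "\<exists>x\<in>E. dist x (fmaps w 0) \<le> r ^ length w * r ^ k" if w: "greedy P w" for w
    proof -
      from P[OF w] obtain \<omega> where "code ((w @ replicate k 1) @- \<omega>) \<in> E"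
        by (auto simp: P_def cell_def)
      moreover have "dist (code ((w @ replicate k 1) @- \<omega>)) (fmaps w 0) \<le> r ^ length w * r ^ k"
        using norm_code_le[of \<omega>] r_pos unfolding code_shift fmaps_simps
        by (simp add: fmaps_append_replicate_1 mult_left_le)
      ultimately show ?thesis by blast
    qed
    then show ?thesis using that by metis
  qed
  \<comment> \<open>The radius is shortened by the displacement of the center, so \<open>B w\<close>
    stays in the ball of radius \<open>(1 - r) * r ^ length w\<close> about the vertex.\<close>
  define B where "B w = cball (x w) ((1 - r - r ^ k) * r ^ length w)" for w
  have compat: "\<not> shadows w w'" "\<not> shadows w' w" if "greedy P w" "greedy P w'" for w w'
    using greedy_not_shadows that by blast+
  have B_disj: "B w \<inter> B w' = {}" if w: "greedy P w" "greedy P w'" "w \<noteq> w'" for w w'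
  proof (rule equals0I)
    fix p assume p: "p \<in> B w \<inter> B w'"
    have "dist p (fmaps v 0) \<le> (1 - r) * r ^ length v" if "p \<in> B v" "greedy P v" for v
    proof -
      have "dist p (fmaps v 0) \<le> dist (x v) p + dist (x v) (fmaps v 0)" by (metis dist_commute dist_triangle)
      also have "\<dots> \<le> (1 - r - r ^ k) * r ^ length v + r ^ length v * r ^ k"
        using that x(2)[of v] by (intro add_mono) (auto simp: B_def)
      finally show ?thesis by (simp add: algebra_simps)
    qed
    from this[of w] this[of w'] p w
    have "dist (fmaps w 0) (fmaps w' 0) \<le> (1 - r) * r ^ length w + (1 - r) * r ^ length w'"
      using dist_triangle3[of "fmaps w 0" "fmaps w' 0" p] by auto
    with centres_apart[OF w(3) compat[OF w(1,2)]] show False by (simp add: algebra_simps)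
  qed
  have rad: "0 < (1 - r - r ^ k) * r ^ length w" for w :: "3 list" using rk r_pos by simp
  have B_inj: "inj_on B (W n)" for n
  proof (rule inj_onI, rule ccontr)
    fix w w' assume *: "w \<in> W n" "w' \<in> W n" "B w = B w'" "w \<noteq> w'"
    then have "B w \<inter> B w' = {}" by (intro B_disj) (auto simp: W_def)
    moreover have "x w \<in> B w" using rad[of w] by (simp add: B_def)
    ultimately show False using * by auto
  qed
  have B_packing: "B ` W n \<in> packings \<delta> E" for n
    unfolding packings_def
  proof (intro CollectI conjI ballI)
    show "countable (B ` W n)" using W_fin by (simp add: uncountable_infinite countable_finite)
    show "disjoint (B ` W n)"
    proof (rule pairwiseI)
      fix S T assume "S \<in> B ` W n" "T \<in> B ` W n" "S \<noteq> T"
      then obtain w w' where "S = B w" "T = B w'" "greedy P w" "greedy P w'" "w \<noteq> w'"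
        by (auto simp: W_def)
      then show "disjnt S T" using B_disj by (simp add: disjnt_def)
    qed
    fix S assume "S \<in> B ` W n"
    then obtain w where w: "greedy P w" "S = B w" by (auto simp: W_def)
    then show "\<exists>x\<in>E. \<exists>\<rho>>0. S = cball x \<rho>" using x(1) rad[of w] B_def by metis
    have "1 - r - r ^ k \<le> 1" using r_pos zero_less_power[of r k] by linarith
    then have "(1 - r - r ^ k) * r ^ length w \<le> 1 * r ^ N"
      using P[OF w(1)] r_pos r_le by (intro mult_mono power_decreasing) (auto simp: P_def)
    then show "diameter S \<le> \<delta>" using N rad[of w] by (simp add: w B_def)
  qed
  have diam: "diameter (B w) powr dim = ?c / 3 ^ length w" for w
  proof -
    have "diameter (B w) = 2 * (1 - r - r ^ k) * r ^ length w" using rad[of w] by (simp add: B_def)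
    moreover have "(r ^ length w) powr dim = (r powr dim) ^ length w"
      using r_pos by (simp add: powr_power powr_powr mult.commute flip: powr_realpow)
    ultimately show ?thesis
      using rk r_pos by (simp only: powr_mult r_powr_dim) (simp add: power_divide)
  qed
  have X_sets: "X w \<in> sets digits" for w
    unfolding X_def by (intro sets.Un sets.finite_UN) auto
  have X_le: "measure digits (X w) \<le> ?q / 3 ^ length w" for w
  proof -
    have "measure digits (X w) \<le> measure digits (cell (w @ [1])) + measure digits (\<Union>a. cell (w @ a # replicate k 1))"
      unfolding X_def by (intro measure_Un_le sets.finite_UN) auto
    also have "measure digits (\<Union>a. cell (w @ a # replicate k 1)) \<le> (\<Sum>a\<in>UNIV. measure digits (cell (w @ a # replicate k 1)))"
      by (intro measure_UNION_le) auto
    finally show ?thesis by (simp add: measure_cell power_add field_simps)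
  qed
  have fin: "ennreal (?c / ?q) * emeasure digits (\<Union>w\<in>W n. X w) \<le> packing_delta dim \<delta> E" for n
  proof -
    have "measure digits (\<Union>w\<in>W n. X w) \<le> (\<Sum>w\<in>W n. measure digits (X w))"
      using W_fin X_sets by (intro measure_UNION_le) auto
    also have "\<dots> \<le> (\<Sum>w\<in>W n. ?q / 3 ^ length w)" by (intro sum_mono X_le)
    finally have "?c / ?q * measure digits (\<Union>w\<in>W n. X w) \<le> ?c / ?q * (\<Sum>w\<in>W n. ?q / 3 ^ length w)"
      by (intro mult_left_mono) auto
    also have "\<dots> = (\<Sum>w\<in>W n. ?c / 3 ^ length w)"
    proof -
      have "?q > 0" by (simp add: add_pos_pos)
      then have "?c / ?q * (?q / 3 ^ l) = ?c / 3 ^ l" for l :: nat by (metis less_irrefl nonzero_mult_div_cancel_right times_divide_eq_left times_divide_eq_right)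
      then show ?thesis by (simp only: sum_distrib_left)
    qed
    finally have "ennreal (?c / ?q * measure digits (\<Union>w\<in>W n. X w)) \<le> ennreal (\<Sum>w\<in>W n. ?c / 3 ^ length w)"
      by (rule ennreal_leI)
    also have "\<dots> = (\<Sum>S\<in>B ` W n. ennreal (diameter S powr dim))"
      by (simp add: sum.reindex[OF B_inj] diam)
    also have "\<dots> \<le> packing_delta dim \<delta> E" using W_fin B_packing by (intro packing_delta_ge) auto
    finally show ?thesis
      unfolding digits.emeasure_eq_measure by (subst ennreal_mult'[symmetric]) auto
  qed
  have "AE \<omega> in digits. \<exists>n\<ge>N. sdrop n \<omega> \<in> cell (replicate k 1)" by (rule AE_run_occurs)
  then obtain Z where Z: "Z \<in> sets digits" "emeasure digits Z = 0"
    "{\<omega>. \<not> (\<exists>n\<ge>N. sdrop n \<omega> \<in> cell (replicate k 1))} \<subseteq> Z"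
    by (auto elim: AE_E)
  have cover: "\<omega> \<in> (\<Union>n. \<Union>w\<in>W n. X w)" if \<omega>: "code \<omega> \<in> E" "\<omega> \<notin> Z" for \<omega>
  proof -
    from \<omega> Z(3) obtain n where n: "N \<le> n" "sdrop n \<omega> \<in> cell (replicate k 1)" by blast
    then obtain \<xi> where "sdrop n \<omega> = replicate k 1 @- \<xi>" by (auto simp: cell_def)
    define w where "w = stake n \<omega>"
    have w: "\<omega> = w @- replicate k 1 @- \<xi>"
      unfolding w_def \<open>sdrop n \<omega> = _\<close>[symmetric] by (rule stake_sdrop[symmetric])
    have "\<omega> \<in> cell (w @ replicate k 1)" by (auto simp: w cell_def)
    with \<omega> n have "P w" by (auto simp: P_def w_def)
    have "\<exists>v. greedy P v \<and> \<omega> \<in> X v"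
    proof (cases "greedy P w")
      case True
      obtain m where "k = Suc m" using k by (cases k) auto
      then have "\<omega> = (w @ [1]) @- replicate m 1 @- \<xi>" by (simp add: w)
      then have "\<omega> \<in> cell (w @ [1])" unfolding cell_def by (rule range_eqI)
      then show ?thesis using True by (auto simp: X_def)
    next
      case False
      with \<open>P w\<close> obtain v where v: "greedy P v" "shadows v w" using greedy.simps[of P w] by blast
      \<comment> \<open>A word rejected by the greedy choice is shadowed by a chosen
        \<open>v\<close>, and both kinds of shadowing put the sequence into \<open>X v\<close>; in
        the second, the \<open>l + k\<close> ones after \<open>v\<close> and \<open>a\<close> begin
        with \<open>k\<close> ones.\<close>
      then have "\<omega> \<in> X v"
        unfolding shadows_def
      proof (elim disjE exE)
        fix u assume "w = v @ 1 # u"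
        then have "\<omega> \<in> cell (v @ [1])" by (auto simp: w cell_def)
        then show ?thesis by (simp add: X_def)
      next
        fix a l assume "w = v @ a # replicate l 1"
        then have "\<omega> = v @- a ## replicate (l + k) 1 @- \<xi>" by (simp add: w replicate_add)
        also have "replicate (l + k) 1 = replicate k 1 @ replicate l (1::3)" by (simp add: add.commute flip: replicate_add)
        finally have "\<omega> \<in> cell (v @ a # replicate k 1)" by (auto simp: cell_def)
        then show ?thesis by (auto simp: X_def)
      qed
      with v show ?thesis by blast
    qed
    then obtain v where "greedy P v" "\<omega> \<in> X v" by blast
    then have "v \<in> W (length v)" by (simp add: W_def)
    with \<open>\<omega> \<in> X v\<close> show ?thesis by blast
  qed
  let ?D = "\<Union>n. \<Union>w\<in>W n. X w"
  have D_sets: "(\<Union>w\<in>W n. X w) \<in> sets digits" for n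
    using W_fin X_sets by (intro sets.finite_UN) auto
  have "emeasure digits (?D \<union> Z) = emeasure digits ?D"
    using Z D_sets by (intro emeasure_Un_null_set sets.countable_UN) (auto simp: null_sets_def)
  \<comment> \<open>The sets increase with n, so the bound from finite packings passes to the
    limit.\<close>
  also have "\<dots> = (SUP n. emeasure digits (\<Union>w\<in>W n. X w))"
    using D_sets by (intro SUP_emeasure_incseq[symmetric]) (auto simp: incseq_def W_def intro: order_trans)
  finally have "ennreal (?c / ?q) * emeasure digits (?D \<union> Z) \<le> packing_delta dim \<delta> E"
    using fin by (simp add: SUP_mult_left_ennreal SUP_least)
  moreover have "?c / ?q = 3 * ?c / (1 + 3 / 3 ^ k)" by simp
  moreover have "?D \<union> Z \<in> sets digits" using D_sets Z by (intro sets.Un sets.countable_UN) auto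
  moreover have "code -` E \<subseteq> ?D \<union> Z" using cover by blast
  ultimately show ?thesis by metis
qed

text \<open>Let the diameters tend to 0 and the run length to infinity together, and intersect the
  resulting supersets. The set \<open>D\<close> replaces the outer measure of the preimage of an
  arbitrary \<open>E\<close>.\<close>

lemma packing_premeasure_lower:
  "\<exists>D\<in>sets digits. code -` E \<subseteq> D \<and>
    ennreal (3 * (2 * (1 - r)) powr dim) * emeasure digits D \<le> packing_premeasure dim E"
proof -
  define c where "c k = 3 * (2 * (1 - r - r ^ k)) powr dim / (1 + 3 / 3 ^ k)" for k
  have "\<exists>D\<in>sets digits. code -` E \<subseteq> D \<and> ennreal (c (Suc n)) * emeasure digits D \<le> packing_delta dim (inverse (Suc n)) E" for n
    unfolding c_def by (intro packing_delta_lower) auto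
  then obtain D where D: "\<And>n. D n \<in> sets digits" "\<And>n. code -` E \<subseteq> D n"
      "\<And>n. ennreal (c (Suc n)) * emeasure digits (D n) \<le> packing_delta dim (inverse (Suc n)) E"
    by metis
  let ?D = "\<Inter>n. D n"
  have D_sets: "?D \<in> sets digits" using D(1) by (intro sets.countable_INT) auto
  have "c \<longlonglongrightarrow> 3 * (2 * (1 - r - 0)) powr dim / (1 + 0)"
    unfolding c_def using r_pos r_le
    by (intro tendsto_intros LIMSEQ_realpow_zero LIMSEQ_divide_realpow_zero) auto
  then have "(\<lambda>n. c (Suc n)) \<longlonglongrightarrow> 3 * (2 * (1 - r)) powr dim"
    by (intro LIMSEQ_Suc) simp
  then have "(\<lambda>n. emeasure digits ?D * ennreal (c (Suc n))) \<longlonglongrightarrow> emeasure digits ?D * ennreal (3 * (2 * (1 - r)) powr dim)"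
    by (intro ennreal_tendsto_cmult tendsto_ennrealI) (auto simp: digits.emeasure_eq_measure)
  moreover have "(\<lambda>n. packing_delta dim (inverse (Suc n)) E) \<longlonglongrightarrow> packing_premeasure dim E"
    by (rule filterlim_compose[OF packing_delta_tendsto])
      (use LIMSEQ_inverse_real_of_nat in \<open>auto simp: filterlim_at\<close>)
  moreover have "emeasure digits ?D * ennreal (c (Suc n)) \<le> packing_delta dim (inverse (Suc n)) E" for n
    using D(1) by (subst mult.commute, intro order_trans[OF mult_left_mono D(3)[of n]] emeasure_mono) auto
  ultimately have "emeasure digits ?D * ennreal (3 * (2 * (1 - r)) powr dim) \<le> packing_premeasure dim E"
    by (intro LIMSEQ_le) auto
  then have "ennreal (3 * (2 * (1 - r)) powr dim) * emeasure digits ?D \<le> packing_premeasure dim E"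
    by (simp only: mult.commute)
  with D_sets D(2) show ?thesis by blast
qed

text \<open>The supersets belonging to the members of a cover exhaust all sequences, so countable
  subadditivity applies.\<close>

lemma packing_measure_ge: "ennreal (3 * (2 * (1 - r)) powr dim) \<le> packing_measure dim (range code)"
  unfolding packing_measure_def
proof (rule INF_greatest)
  let ?C = "ennreal (3 * (2 * (1 - r)) powr dim)"
  fix U :: "nat \<Rightarrow> (real^2) set" assume U: "U \<in> {U. range code \<subseteq> (\<Union>i. U i)}"
  have "\<forall>i. \<exists>D. D \<in> sets digits \<and> code -` U i \<subseteq> D \<and> ?C * emeasure digits D \<le> packing_premeasure dim (U i)"
    using packing_premeasure_lower by blast
  from choice[OF this] obtain D where "\<forall>i. D i \<in> sets digits \<and> code -` U i \<subseteq> D i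
      \<and> ?C * emeasure digits (D i) \<le> packing_premeasure dim (U i)" ..
  then have D: "D i \<in> sets digits" "code -` U i \<subseteq> D i"
      "?C * emeasure digits (D i) \<le> packing_premeasure dim (U i)" for i
    by simp_all
  have "\<exists>i. \<omega> \<in> D i" for \<omega>
  proof -
    from U obtain i where "code \<omega> \<in> U i" by blast
    then have "\<omega> \<in> D i" using D(2)[of i] by blast
    then show ?thesis ..
  qed
  then have "(\<Union>i. D i) = space digits" by auto
  then have "?C = ?C * emeasure digits (\<Union>i. D i)" using digits.emeasure_space_1 by simp
  also have "\<dots> \<le> ?C * (\<Sum>i. emeasure digits (D i))"
    using D(1) by (intro mult_left_mono emeasure_subadditive_countably) auto
  also have "\<dots> = (\<Sum>i. ?C * emeasure digits (D i))" by simp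
  also have "\<dots> \<le> (\<Sum>i. packing_premeasure dim (U i))"
    using D(3) by (intro suminf_le) auto
  finally show "?C \<le> (\<Sum>i. packing_premeasure dim (U i))" .
qed

end

theorem theorem2:
  fixes r :: real
  assumes "0 < r" and "r \<le> 1/3"
  shows "packing_measure (gasket_dim r) (sierpinski_gasket r)
    = ennreal ((2 * ((1 - r) / r)) powr gasket_dim r)"
proof -
  interpret gasket r by unfold_locales (fact assms)+
  have "(2 * ((1 - r) / r)) powr dim = (2 * (1 - r)) powr dim / r powr dim"
    unfolding times_divide_eq_right by (rule powr_divide)
  also have "\<dots> = 3 * (2 * (1 - r)) powr dim" by (simp add: r_powr_dim)
  finally show ?thesis
    unfolding sierpinski_gasket_eq using packing_measure_le packing_measure_ge by (simp add: antisym)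
qed

end
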